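(* For all integers $s,t\ge 2$ and $n\ge s+t-2$, \[ f_{s+t-2}(n,s,t)=g(n,s,t). \]
   Context: For integers $n\ge k\ge s,t\ge 2$, $f_k(n,s,t)$ denotes the least integer $N$ with the following property: for every coloring of the $k$-element subsets of $\{1,\dots,N\}$ with the two colors red and blue, there is a subset $A\subseteq\{1,\dots,N\}$ with $|A|=n$ such that either every $s$-element subset of $A$ is contained in some red $k$-element subset of $\{1,\dots,N\}$, or every $t$-element subset of $A$ is contained in some blue $k$-element subset of $\{1,\dots,N\}$ (the $k$-subsets need not be contained in $A$). $g(n,s,t)$ denotes the smallest integer $N$ such that every graph $G$ on $N$ vertices has a set $A$ of $n$ vertices which does not contain both a clique of size $s$ and an independent set of size $t$; that is, the induced subgraph $G[A]$ has no clique of size $s$, or $G[A]$ has no independent set of size $t$. *)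

theory Defs
  imports "HOL-Library.Ramsey"
begin

datatype colour = Red | Blue

text \<open>A colouring of the \<open>k\<close>-subsets of \<open>{1..N}\<close> is a total function on sets of naturals; only its
  values on \<open>[{1..N}]\<^bsup>k\<^esup>\<close> matter. The \<open>k\<close>-set containing \<open>S\<close> ranges over subsets of \<open>V\<close>, which is
  the ground set \<open>{1..N}\<close> below, and not merely over subsets of \<open>A\<close>.\<close>

definition covers :: "(nat set \<Rightarrow> colour) \<Rightarrow> colour \<Rightarrow> nat set \<Rightarrow> nat \<Rightarrow> nat \<Rightarrow> nat set \<Rightarrow> bool"
  where "covers c i V k s A \<longleftrightarrow> (\<forall>S\<in>[A]\<^bsup>s\<^esup>. \<exists>e\<in>[V]\<^bsup>k\<^esup>. c e = i \<and> S \<subseteq> e)"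

definition f_prop :: "nat \<Rightarrow> nat \<Rightarrow> nat \<Rightarrow> nat \<Rightarrow> nat \<Rightarrow> bool"
  where "f_prop k n s t N \<longleftrightarrow>
    (\<forall>c :: nat set \<Rightarrow> colour. \<exists>A\<in>[{1..N}]\<^bsup>n\<^esup>.
       covers c Red {1..N} k s A \<or> covers c Blue {1..N} k t A)"

definition f_num :: "nat \<Rightarrow> nat \<Rightarrow> nat \<Rightarrow> nat \<Rightarrow> nat"
  where "f_num k n s t = (LEAST N. f_prop k n s t N)"

definition has_clique :: "nat set \<Rightarrow> nat set set \<Rightarrow> nat \<Rightarrow> bool"
  where "has_clique A E s \<longleftrightarrow> (\<exists>K\<in>[A]\<^bsup>s\<^esup>. clique K E)"

definition has_indep :: "nat set \<Rightarrow> nat set set \<Rightarrow> nat \<Rightarrow> bool"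
  where "has_indep A E t \<longleftrightarrow> (\<exists>I\<in>[A]\<^bsup>t\<^esup>. indep I E)"

text \<open>The graph is \<open>(V, E)\<close>, with edges being two-element sets of vertices. Since every finite graph is
  isomorphic to one whose vertices are natural numbers, taking \<open>V\<close> to be a set of naturals loses no
  generality.\<close>

definition g_prop :: "nat \<Rightarrow> nat \<Rightarrow> nat \<Rightarrow> nat \<Rightarrow> bool"
  where "g_prop n s t N \<longleftrightarrow>
    (\<forall>V E. finite V \<and> card V = N \<and> E \<subseteq> [V]\<^bsup>2\<^esup> \<longrightarrow>
       (\<exists>A\<in>[V]\<^bsup>n\<^esup>. \<not> (has_clique A E s \<and> has_indep A E t)))"

definition g_num :: "nat \<Rightarrow> nat \<Rightarrow> nat \<Rightarrow> nat"
  where "g_num n s t = (LEAST N. g_prop n s t N)"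

text \<open>\<open>LEAST\<close> is unspecified on an empty set of naturals. By Ramsey's theorem this does not happen here,
  so both numbers are the minima they are meant to be.\<close>

lemma ex_f_prop:
  assumes "s \<le> k" "t \<le> k" "k \<le> n"
  shows "\<exists>N. f_prop k n s t N"
proof -
  obtain N where N: "partn_lst {..<N::nat} [n,n] k"
    using ramsey_full by blast
  have "\<exists>A\<in>[{1..N}]\<^bsup>n\<^esup>. covers c Red {1..N} k s A \<or> covers c Blue {1..N} k t A" for c
  proof -
    define h where "h = (\<lambda>X. if c (Suc ` X) = Red then 0 else Suc 0)"
    have "h \<in> [{..<N}]\<^bsup>k\<^esup> \<rightarrow> {..<2}"
      by (auto simp: h_def)
    then obtain i H where i: "i < length [n,n]" and H: "H \<in> [{..<N}]\<^bsup>([n,n] ! i)\<^esup>"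
      and hH: "h ` [H]\<^bsup>k\<^esup> \<subseteq> {i}"
      using partn_lstE[OF N, of h 2] by auto
    have "[n,n] ! i = n"
      using i by (cases i) auto
    with H have Hn: "H \<subseteq> {..<N}" "finite H" "card H = n"
      by (auto simp: nsets_def)
    define A where "A = Suc ` H"
    have AV: "A \<subseteq> {1..N}"
      using Hn by (force simp: A_def)
    have finA: "finite A" and cardA: "card A = n"
      using Hn by (auto simp: A_def card_image)
    define j where "j = (if i = 0 then Red else Blue)"
    have mono: "c e = j" if e: "e \<in> [A]\<^bsup>k\<^esup>" for e
    proof -
      obtain Y where "Y \<in> [H]\<^bsup>k\<^esup>" and Y: "e = Suc ` Y"
        using nset_image_obtains[of e Suc H k] e by (auto simp: A_def)
      with hH have "h Y = i"
        by auto
      with Y show ?thesis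
        by (cases "c e") (auto simp: h_def j_def)
    qed
    have cov: "covers c j {1..N} k r A" if rk: "r \<le> k" for r
      unfolding covers_def
    proof
      fix S assume "S \<in> [A]\<^bsup>r\<^esup>"
      then have S: "S \<subseteq> A" "card S = r"
        by (auto simp: nsets_def)
      then obtain e where e: "S \<subseteq> e" "e \<subseteq> A" "card e = k"
        using exists_subset_between[of S k A] rk assms(3) finA cardA by auto
      with finA have "e \<in> [A]\<^bsup>k\<^esup>"
        by (auto simp: nsets_def finite_subset)
      moreover from this have "e \<in> [{1..N}]\<^bsup>k\<^esup>"
        using nsets_mono[OF AV] by (rule subsetD[rotated])
      ultimately show "\<exists>e\<in>[{1..N}]\<^bsup>k\<^esup>. c e = j \<and> S \<subseteq> e"
        using mono e(1) by blast
    qed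
    have "A \<in> [{1..N}]\<^bsup>n\<^esup>"
      using AV finA cardA by (auto simp: nsets_def)
    moreover have "covers c Red {1..N} k s A \<or> covers c Blue {1..N} k t A"
      using cov[of s] cov[of t] assms by (cases j) auto
    ultimately show ?thesis
      by blast
  qed
  then show ?thesis
    unfolding f_prop_def by blast
qed

lemma ex_g_prop:
  assumes "2 \<le> s" "2 \<le> t"
  shows "\<exists>N. g_prop n s t N"
proof -
  obtain r where r: "\<And>(V::nat set) E. finite V \<Longrightarrow> card V \<ge> r \<Longrightarrow>
      \<exists>R \<subseteq> V. card R = n \<and> clique R E \<or> card R = n \<and> indep R E"
    using ramsey2[of n n, where 'a = nat] by meson
  have "g_prop n s t r"
    unfolding g_prop_def
  proof (intro allI impI)
    fix V :: "nat set" and E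
    assume V: "finite V \<and> card V = r \<and> E \<subseteq> [V]\<^bsup>2\<^esup>"
    then obtain R where R: "R \<subseteq> V" "card R = n" "clique R E \<or> indep R E"
      using r[of V E] by auto
    have big: "\<exists>x\<in>X. \<exists>y\<in>X. x \<noteq> y" if "X \<in> [R]\<^bsup>m\<^esup>" "2 \<le> m" for X m
    proof -
      have "finite X" "\<not> card X \<le> Suc 0"
        using that by (auto simp: nsets_def)
      then show ?thesis
        using card_le_Suc0_iff_eq by blast
    qed
    have "\<not> (has_clique R E s \<and> has_indep R E t)"
    proof
      assume "has_clique R E s \<and> has_indep R E t"
      then obtain K I where K: "K \<in> [R]\<^bsup>s\<^esup>" "clique K E" and I: "I \<in> [R]\<^bsup>t\<^esup>" "indep I E"
        by (auto simp: has_clique_def has_indep_def)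
      moreover have "K \<subseteq> R" "I \<subseteq> R"
        using K I by (auto simp: nsets_def)
      ultimately show False
        using R(3) big[OF K(1) assms(1)] big[OF I(1) assms(2)]
        unfolding clique_def indep_def by (meson subsetD)
    qed
    moreover have "R \<in> [V]\<^bsup>n\<^esup>"
      using R V by (auto simp: nsets_def finite_subset)
    ultimately show "\<exists>A\<in>[V]\<^bsup>n\<^esup>. \<not> (has_clique A E s \<and> has_indep A E t)"
      by blast
  qed
  then show ?thesis
    by blast
qed

end

theory Submission
  imports Defs
begin

text \<open>Both numbers are least elements of the same set of \<open>N\<close>. Put \<open>k = s + t - 2\<close>. Given a graph
  in which every \<open>n\<close>-set contains an \<open>s\<close>-clique and an independent \<open>t\<close>-set, colour a \<open>k\<close>-set blue
  iff it contains an \<open>s\<close>-clique: a clique and an independent set share at most one vertex, so no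
  \<open>k\<close>-set contains both. Conversely, given a bad colouring, consider the \<open>s\<close>-sets in no red
  \<open>k\<close>-set and the \<open>t\<close>-sets in no blue \<open>k\<close>-set. One of each cannot lie in a common \<open>k\<close>-set, hence
  they share at most one vertex, and joining all pairs inside the former makes the former cliques
  and the latter independent.\<close>

text \<open>Two distinct common vertices would be both adjacent and non-adjacent.\<close>

lemma card_Int_clique_indep_le_1:
  assumes "clique K E" "indep I E" "finite K"
  shows "card (K \<inter> I) \<le> 1"
  using assms card_le_Suc0_iff_eq[of "K \<inter> I"] unfolding clique_def indep_def by auto

lemma card_Un_ge_of_card_Int_le_1:
  assumes "finite K" "finite I" "card (K \<inter> I) \<le> 1"
  shows "card K + card I \<le> Suc (card (K \<union> I))"
  using card_Un_Int[OF assms(1,2)] assms(3) by simp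

lemma g_prop_if_f_prop:
  assumes "2 \<le> s" "f_prop (s + t - 2) n s t N"
  shows "g_prop n s t N"
  unfolding g_prop_def
proof (intro allI impI)
  fix V :: "nat set" and E :: "nat set set"
  assume V: "finite V \<and> card V = N \<and> E \<subseteq> [V]\<^bsup>2\<^esup>"
  \<comment> \<open>The graph lives on an arbitrary \<open>V\<close>, the colouring on
    \<open>{1..N}\<close>; \<open>h\<close> carries one to the other.\<close>
  obtain h where h: "bij_betw h {1..N} V"
    using V by (metis card_atLeastAtMost diff_Suc_1 finite_atLeastAtMost finite_same_card_bij)
  then have inj: "inj_on h {1..N}" and hV: "h ` {1..N} = V"
    by (auto simp: bij_betw_def)
  define c where "c = (\<lambda>e. if has_clique (h ` e) E s then Blue else Red)"
  obtain A where A: "A \<in> [{1..N}]\<^bsup>n\<^esup>" and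
    cov: "covers c Red {1..N} (s + t - 2) s A \<or> covers c Blue {1..N} (s + t - 2) t A"
    using assms(2) unfolding f_prop_def by blast
  have AN: "A \<subseteq> {1..N}"
    using A by (auto simp: nsets_def)
  have hA: "h ` A \<in> [V]\<^bsup>n\<^esup>"
    using A hV card_image[OF inj_on_subset[OF inj AN]] by (auto simp: nsets_def)
  have "\<not> (has_clique (h ` A) E s \<and> has_indep (h ` A) E t)"
  proof
    assume "has_clique (h ` A) E s \<and> has_indep (h ` A) E t"
    then obtain K I where K: "K \<in> [h ` A]\<^bsup>s\<^esup>" "clique K E" and I: "I \<in> [h ` A]\<^bsup>t\<^esup>" "indep I E"
      by (auto simp: has_clique_def has_indep_def)
    obtain S where S: "S \<in> [A]\<^bsup>s\<^esup>" "K = h ` S"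
      using nset_image_obtains[OF K(1) inj_on_subset[OF inj AN]] by blast
    obtain T where T: "T \<in> [A]\<^bsup>t\<^esup>" "I = h ` T"
      using nset_image_obtains[OF I(1) inj_on_subset[OF inj AN]] by blast
    from cov show False
    proof
      assume "covers c Red {1..N} (s + t - 2) s A"
      then obtain e where e: "c e = Red" "S \<subseteq> e"
        using S(1) unfolding covers_def by blast
      have "K \<in> [h ` e]\<^bsup>s\<^esup>"
        using K(1) S(2) e(2) by (auto simp: nsets_def)
      with K(2) e(1) show False
        by (auto simp: c_def has_clique_def split: if_splits)
    next
      assume "covers c Blue {1..N} (s + t - 2) t A"
      then obtain e where e: "e \<in> [{1..N}]\<^bsup>(s + t - 2)\<^esup>" "c e = Blue" "T \<subseteq> e"
        using T(1) unfolding covers_def by blast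
      \<comment> \<open>This clique comes from the colour of \<open>e\<close> and may leave
        \<open>h\<close> A\<open>. Together with\<close>I\<open>it needs at least\<close>s + t -
        1\<open>vertices of\<close>h \<open>e\<close>, one more than there are.\<close>
      then obtain K' where K': "K' \<in> [h ` e]\<^bsup>s\<^esup>" "clique K' E"
        by (auto simp: c_def has_clique_def split: if_splits)
      have fin: "finite e" "finite K'" "finite I" and
        cards: "card e = s + t - 2" "card K' = s" "card I = t"
        using e K' I by (auto simp: nsets_def)
      have "s + t \<le> Suc (card (K' \<union> I))"
        using card_Un_ge_of_card_Int_le_1[OF fin(2,3) card_Int_clique_indep_le_1[OF K'(2) I(2) fin(2)]]
          cards by simp
      also have "card (K' \<union> I) \<le> card (h ` e)"
        using K'(1) T(2) e(3) fin(1) by (intro card_mono) (auto simp: nsets_def)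
      also have "card (h ` e) \<le> s + t - 2"
        using card_image_le[OF fin(1), of h] cards by simp
      finally show False
        using assms(1) by simp
    qed
  qed
  with hA show "\<exists>A\<in>[V]\<^bsup>n\<^esup>. \<not> (has_clique A E s \<and> has_indep A E t)"
    by blast
qed

lemma f_prop_if_g_prop:
  assumes "s + t - 2 \<le> n" "g_prop n s t N"
  shows "f_prop (s + t - 2) n s t N"
  unfolding f_prop_def
proof
  fix c :: "nat set \<Rightarrow> colour"
  define k where "k = s + t - 2"
  define V where "V = {1..N}"
  define F where "F = {S \<in> [V]\<^bsup>s\<^esup>. \<forall>e\<in>[V]\<^bsup>k\<^esup>. S \<subseteq> e \<longrightarrow> c e \<noteq> Red}"
  define E where "E = (\<Union>S\<in>F. [S]\<^bsup>2\<^esup>)"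
  have "E \<subseteq> [V]\<^bsup>2\<^esup>"
    by (auto simp: E_def F_def nsets_def)
  then obtain A where A: "A \<in> [V]\<^bsup>n\<^esup>" and nA: "\<not> (has_clique A E s \<and> has_indep A E t)"
    using assms(2) unfolding g_prop_def by (metis V_def card_atLeastAtMost diff_Suc_1 finite_atLeastAtMost)
  have AV: "A \<subseteq> V" "card A = n" "finite V"
    using A by (auto simp: nsets_def V_def)
  \<comment> \<open>Leaves room in \<open>V\<close> to enlarge a smaller set to a
    \<open>k\<close>-set; this is where \<open>n \<ge> s + t - 2\<close> enters.\<close>
  have kV: "k \<le> card V"
    using card_mono[OF AV(3,1)] AV(2) assms(1) by (simp add: k_def)
  have "covers c Red V k s A \<or> covers c Blue V k t A"
  proof (rule ccontr)
    assume "\<not> ?thesis"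
    then obtain S T where S: "S \<in> [A]\<^bsup>s\<^esup>" "\<forall>e\<in>[V]\<^bsup>k\<^esup>. S \<subseteq> e \<longrightarrow> c e \<noteq> Red"
      and T: "T \<in> [A]\<^bsup>t\<^esup>" "\<forall>e\<in>[V]\<^bsup>k\<^esup>. T \<subseteq> e \<longrightarrow> c e \<noteq> Blue"
      unfolding covers_def by blast
    have "S \<in> F"
      using S nsets_mono[OF AV(1)] by (auto simp: F_def)
    then have "clique S E"
      unfolding clique_def E_def by (force simp: nsets_def)
    then have "has_clique A E s"
      using S(1) by (auto simp: has_clique_def)
    moreover have "indep T E"
      unfolding indep_def
    proof (intro ballI impI notI)
      fix x y assume xy: "x \<in> T" "y \<in> T" "x \<noteq> y" "{x, y} \<in> E"
      \<comment> \<open>The edge may stem from any member of \<open>F\<close>, not only from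
        \<open>S\<close> or from a subset of \<open>A\<close>.\<close>
      then obtain R where R: "R \<in> F" "{x, y} \<subseteq> R"
        by (auto simp: E_def nsets_def)
      have fin: "finite R" "finite T" and cards: "card R = s" "card T = t"
        and sub: "R \<subseteq> V" "T \<subseteq> V"
        using R(1) T(1) AV(1) by (auto simp: F_def nsets_def)
      have "card {x, y} \<le> card (R \<inter> T)"
        using xy R(2) fin by (intro card_mono) auto
      \<comment> \<open>Two shared vertices bring the union down to \<open>s + t - 2\<close>, which
        is exactly \<open>k\<close>. A \<open>k\<close>-set around it can be neither red, because of
        \<open>R\<close>, nor blue, because of \<open>T\<close>.\<close>
      then have "card (R \<union> T) \<le> k"
        using card_Un_Int[OF fin] cards xy(3) by (simp add: k_def)
      then obtain e where e: "R \<union> T \<subseteq> e" "e \<subseteq> V" "card e = k"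
        using exists_subset_between[of "R \<union> T" k V] kV sub AV(3) by auto
      then have "e \<in> [V]\<^bsup>k\<^esup>"
        using AV(3) by (auto simp: nsets_def intro: finite_subset)
      then have "c e \<noteq> Red" "c e \<noteq> Blue"
        using e(1) R(1) T(2) by (auto simp: F_def)
      then show False
        by (cases "c e") auto
    qed
    then have "has_indep A E t"
      using T(1) by (auto simp: has_indep_def)
    ultimately show False
      using nA by blast
  qed
  then show "\<exists>A\<in>[{1..N}]\<^bsup>n\<^esup>. covers c Red {1..N} (s + t - 2) s A \<or>
      covers c Blue {1..N} (s + t - 2) t A"
    using A unfolding V_def k_def by blast
qed

theorem lemma2p1:
  fixes n s t :: nat
  assumes "s \<ge> 2" and "t \<ge> 2" and "n \<ge> s + t - 2"
  shows "f_num (s + t - 2) n s t = g_num n s t"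
proof -
  have "f_prop (s + t - 2) n s t = g_prop n s t"
    using g_prop_if_f_prop[OF assms(1)] f_prop_if_g_prop[OF assms(3)] by blast
  then show ?thesis
    by (simp add: f_num_def g_num_def)
qed

end
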